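(* Every nilpotent subgroup of $\mathrm{Diff}^2(\mathbf{R})$ is metabelian, i.e. has abelian commutator subgroup.
   Context: $\mathrm{Diff}^{2}(\mathbf{R})$ denotes the group of orientation-preserving $C^2$ diffeomorphisms of the real line, under composition. *)

theory Defs
  imports "HOL-Analysis.Analysis" "HOL-Algebra.Generated_Groups"
begin

definition C2_differentiable :: "(real \<Rightarrow> real) \<Rightarrow> bool" where
  "C2_differentiable f \<longleftrightarrow>
     (\<exists>f'. (\<forall>x. (f has_real_derivative f' x) (at x)) \<and> f' C1_differentiable_on UNIV)"

text \<open>\<^term>\<open>inv_into UNIV f\<close> is the inverse function of \<^term>\<open>f\<close>; the notation \<open>inv\<close> is left to
  the inverse of a group. Orientation-preserving means increasing.\<close>

definition Diff2R :: "(real \<Rightarrow> real) monoid" where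
  "Diff2R =
     \<lparr>carrier = {f. bij f \<and> C2_differentiable f \<and> C2_differentiable (inv_into UNIV f) \<and> strict_mono f},
      mult = (\<circ>),
      one = id\<rparr>"

definition commutator_subgroup :: "('a, 'b) monoid_scheme \<Rightarrow> 'a set \<Rightarrow> 'a set \<Rightarrow> 'a set" where
  "commutator_subgroup G H K =
     generate G (\<Union>h\<in>H. \<Union>k\<in>K. {h \<otimes>\<^bsub>G\<^esub> k \<otimes>\<^bsub>G\<^esub> inv\<^bsub>G\<^esub> h \<otimes>\<^bsub>G\<^esub> inv\<^bsub>G\<^esub> k})"

text \<open>The series is indexed from 0, so \<open>lower_central_series G n\<close> is the term usually written
  with index \<open>n + 1\<close>.\<close>

primrec lower_central_series :: "('a, 'b) monoid_scheme \<Rightarrow> nat \<Rightarrow> 'a set" where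
  "lower_central_series G 0 = carrier G"
| "lower_central_series G (Suc n) = commutator_subgroup G (carrier G) (lower_central_series G n)"

definition nilpotent :: "('a, 'b) monoid_scheme \<Rightarrow> bool" where
  "nilpotent G \<longleftrightarrow> (\<exists>n. lower_central_series G n = {\<one>\<^bsub>G\<^esub>})"

definition metabelian :: "('a, 'b) monoid_scheme \<Rightarrow> bool" where
  "metabelian G \<longleftrightarrow> comm_group (G\<lparr>carrier := derived G (carrier G)\<rparr>)"

lemma derived_eq_commutator_subgroup: "derived G H = commutator_subgroup G H H"
  by (simp add: derived_def commutator_subgroup_def)

lemma C2_differentiable_id: "C2_differentiable id"
  unfolding C2_differentiable_def
  by (rule exI[of _ "\<lambda>_. 1"]) (auto simp: id_def)

lemma C2_differentiable_comp:
  assumes "C2_differentiable f" "C2_differentiable g"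
  shows "C2_differentiable (f \<circ> g)"
proof -
  obtain f' g' where f: "\<And>x. (f has_real_derivative f' x) (at x)" "f' C1_differentiable_on UNIV"
    and g: "\<And>x. (g has_real_derivative g' x) (at x)" "g' C1_differentiable_on UNIV"
    using assms unfolding C2_differentiable_def by blast
  have gC1: "g C1_differentiable_on UNIV"
    unfolding C1_differentiable_on_def
    using g C1_differentiable_imp_continuous_on has_real_derivative_iff_has_vector_derivative by blast
  have "(f' \<circ> g) C1_differentiable_on UNIV"
  proof -
    obtain D where D: "\<And>x. (f' has_real_derivative D x) (at x)" "continuous_on UNIV D"
      using f(2) unfolding C1_differentiable_on_def
      by (auto simp: has_real_derivative_iff_has_vector_derivative)
    have "((f' \<circ> g) has_real_derivative D (g x) * g' x) (at x)" for x
      unfolding o_def by (rule DERIV_chain2[OF D(1) g(1)])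
    moreover have "continuous_on UNIV (\<lambda>x. D (g x) * g' x)"
      by (intro continuous_intros continuous_on_compose2[OF D(2)]
            C1_differentiable_imp_continuous_on[OF gC1]
            C1_differentiable_imp_continuous_on[OF g(2)]) auto
    ultimately show ?thesis
      unfolding C1_differentiable_on_def
      by (intro exI[of _ "\<lambda>x. D (g x) * g' x"])
        (auto simp: has_real_derivative_iff_has_vector_derivative)
  qed
  then have "(\<lambda>x. f' (g x) * g' x) C1_differentiable_on UNIV"
    using C1_differentiable_on_mult g(2) by (auto simp: o_def)
  moreover have "((f \<circ> g) has_real_derivative f' (g x) * g' x) (at x)" for x
    unfolding o_def by (rule DERIV_chain2[OF f(1) g(1)])
  ultimately show ?thesis
    unfolding C2_differentiable_def by (intro exI[of _ "\<lambda>x. f' (g x) * g' x"]) auto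
qed

lemma group_Diff2R: "group Diff2R"
proof (rule groupI)
  fix f g assume "f \<in> carrier Diff2R" "g \<in> carrier Diff2R"
  then show "f \<otimes>\<^bsub>Diff2R\<^esub> g \<in> carrier Diff2R"
    by (auto simp: Diff2R_def bij_comp o_inv_distrib strict_mono_def intro!: C2_differentiable_comp)
next
  show "\<one>\<^bsub>Diff2R\<^esub> \<in> carrier Diff2R"
    by (auto simp: Diff2R_def C2_differentiable_id strict_mono_def)
next
  fix f assume f: "f \<in> carrier Diff2R"
  then have b: "bij f" and m: "strict_mono f" by (auto simp: Diff2R_def)
  have "strict_mono (inv_into UNIV f)"
    using m b by (metis bij_inv_eq_iff strict_mono_def strict_mono_less)
  with f have "inv_into UNIV f \<in> carrier Diff2R"
    by (auto simp: Diff2R_def bij_imp_bij_inv inv_inv_eq)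
  moreover have "inv_into UNIV f \<otimes>\<^bsub>Diff2R\<^esub> f = \<one>\<^bsub>Diff2R\<^esub>"
    using b by (auto simp: Diff2R_def bij_is_inj)
  ultimately show "\<exists>y\<in>carrier Diff2R. y \<otimes>\<^bsub>Diff2R\<^esub> f = \<one>\<^bsub>Diff2R\<^esub>" by blast
qed (auto simp: Diff2R_def o_assoc)

end

theory Submission
  imports Defs
begin

text \<open>Let \<open>f\<close>, \<open>g\<close> lie in the commutator subgroup \<open>K\<close> of a nilpotent group of \<open>C\<^sup>2\<close> diffeomorphisms.
  Going down the lower central series, one may assume that \<open>z = [g, f]\<close> commutes with \<open>f\<close> and
  \<open>g\<close>. If the powers of \<open>z\<close> were cofinal in an invariant set, then every increasing map commuting with
  \<open>z\<close> would move points by at most a fixed power of \<open>z\<close>, so that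
  \<open>z ^ (n * n) = [g ^ n, f ^ n]\<close> would be bounded by \<open>z ^ (C * n)\<close>, which is absurd. The same linear
  bound, applied on the common fixed point sets of the terms of the lower central series, shows
  that every element of \<open>K\<close> has a fixed point. A Kopell argument then shows that \<open>f\<close> and \<open>g\<close>
  fix the endpoints of every component of the complement of the fixed point set of \<open>z\<close>; such a
  component is therefore invariant, and hence there is none.\<close>

subsection \<open>Maps commuting with a cofinal map\<close>

text \<open>\<open>X\<close> need not be an interval: later it is a common fixed point set or a
  component of the complement of a fixed point set. As \<open>z\<close> is not assumed onto, only
  its forward powers are used.\<close>

locale cofinal_map =
  fixes z :: "'a::linorder \<Rightarrow> 'a" and X :: "'a set"
  assumes mono_z: "strict_mono z"
    and z_in: "x \<in> X \<Longrightarrow> z x \<in> X"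
    and cofinal: "x \<in> X \<Longrightarrow> y \<in> X \<Longrightarrow> \<exists>n. y < (z ^^ n) x"
begin

definition centralizes :: "('a \<Rightarrow> 'a) \<Rightarrow> bool" where
  "centralizes h \<longleftrightarrow> mono h \<and> (\<forall>x\<in>X. h x \<in> X \<and> h (z x) = z (h x))"

text \<open>This is the two-sided bound of \<open>h x\<close> between the powers \<open>-C\<close>
  and \<open>C\<close> of \<open>z\<close>, with the negative power moved to the other side.\<close>

definition dominated :: "('a \<Rightarrow> 'a) \<Rightarrow> nat \<Rightarrow> bool" where
  "dominated h C \<longleftrightarrow> (\<forall>x\<in>X. h x \<le> (z ^^ C) x \<and> x \<le> (z ^^ C) (h x))"

text \<open>Quadratic distortion relative to \<open>z\<close>: a power of order \<open>n * n\<close>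
  displaces points by only linearly many powers of \<open>z\<close>.\<close>

definition slow :: "('a \<Rightarrow> 'a) \<Rightarrow> bool" where
  "slow c \<longleftrightarrow> (\<exists>C. \<forall>n. dominated (c ^^ (n * n)) (C * n))"

lemma mono_zpow: "x \<le> y \<Longrightarrow> (z ^^ n) x \<le> (z ^^ n) y"
  using funpow_mono strict_mono_mono[OF mono_z] by blast

lemma zpow_le_iff: "(z ^^ n) x \<le> (z ^^ n) y \<longleftrightarrow> x \<le> y"
  by (induction n) (auto simp: strict_mono_less_eq[OF mono_z])

lemma zpow_in: "x \<in> X \<Longrightarrow> (z ^^ n) x \<in> X"
  by (induction n) (auto simp: z_in)

lemma less_z:
  assumes "x \<in> X" shows "x < z x"
proof (rule ccontr)
  assume "\<not> x < z x"
  then have le: "z x \<le> x" by simp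
  have "(z ^^ n) x \<le> x" for n
  proof (induction n)
    case (Suc n)
    then show ?case using le strict_mono_mono[OF mono_z] by (auto dest: monoD intro: order_trans)
  qed auto
  then show False using cofinal[OF assms assms] by (auto simp: not_less[symmetric])
qed

lemma zpow_le: "x \<in> X \<Longrightarrow> x \<le> (z ^^ n) x"
  by (induction n) (auto intro: order_trans less_imp_le[OF less_z] zpow_in)

lemma zpow_le_zpow:
  assumes "x \<in> X" "m \<le> n" shows "(z ^^ m) x \<le> (z ^^ n) x"
proof -
  have "(z ^^ n) x = (z ^^ m) ((z ^^ (n - m)) x)"
    using assms(2) by (metis funpow_add le_add_diff_inverse o_apply)
  then show ?thesis using mono_zpow[OF zpow_le[OF assms(1)]] by simp
qed

lemma centralizes_id: "centralizes id"
  by (auto simp: centralizes_def mono_def)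

lemma centralizes_comp: "centralizes g \<Longrightarrow> centralizes h \<Longrightarrow> centralizes (g \<circ> h)"
  by (auto simp: centralizes_def mono_def)

lemma centralizes_funpow: "centralizes h \<Longrightarrow> centralizes (h ^^ n)"
  by (induction n) (auto simp: centralizes_comp centralizes_id)

lemma centralizesD:
  assumes "centralizes h"
  shows "x \<le> y \<Longrightarrow> h x \<le> h y" "x \<in> X \<Longrightarrow> h x \<in> X"
    "x \<in> X \<Longrightarrow> h ((z ^^ n) x) = (z ^^ n) (h x)"
proof -
  show "x \<le> y \<Longrightarrow> h x \<le> h y" "x \<in> X \<Longrightarrow> h x \<in> X"
    using assms by (auto simp: centralizes_def mono_def)
  show "x \<in> X \<Longrightarrow> h ((z ^^ n) x) = (z ^^ n) (h x)"
    using assms by (induction n) (auto simp: centralizes_def zpow_in)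
qed

lemma zpow_add: "(z ^^ (m + n)) x = (z ^^ m) ((z ^^ n) x)"
  by (simp add: funpow_add)

text \<open>A bound \<open>N\<close> at one base point \<open>x0\<close> spreads to all of
  \<open>X\<close>: a point between two consecutive iterates of \<open>x0\<close> inherits it by
  monotonicity and commutation, at the cost of one more power of \<open>z\<close>.\<close>

lemma centralizes_dominated:
  assumes h: "centralizes h"
  shows "\<exists>C. dominated h C"
proof (cases "X = {}")
  case True
  then have "dominated h 0" unfolding dominated_def by simp
  then show ?thesis by blast
next
  case False
  then obtain x0 where x0: "x0 \<in> X" by blast
  note hx0 = centralizesD(2)[OF h x0]
  obtain N1 where N1: "h x0 < (z ^^ N1) x0" using cofinal[OF x0 hx0] by blast
  obtain N2 where N2: "x0 < (z ^^ N2) (h x0)" using cofinal[OF hx0 x0] by blast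
  define N where "N = max N1 N2"
  have N: "h x0 \<le> (z ^^ N) x0" "x0 \<le> (z ^^ N) (h x0)"
    using less_le_trans[OF N1 zpow_le_zpow[OF x0, of N1 N]]
      less_le_trans[OF N2 zpow_le_zpow[OF hx0, of N2 N]] by (simp_all add: N_def)
  have ge: "h x \<le> (z ^^ Suc N) x \<and> x \<le> (z ^^ Suc N) (h x)" if x: "x \<in> X" "x0 \<le> x" for x
  proof -
    \<comment> \<open>Minimality places \<open>x\<close> in the fundamental domain from
      \<open>(z ^^ m) x0\<close> to \<open>(z ^^ Suc m) x0\<close>.\<close>
    define n where "n = (LEAST n. x < (z ^^ n) x0)"
    have n: "x < (z ^^ n) x0" unfolding n_def using cofinal[OF x0 x(1)] by (rule LeastI_ex)
    have "n \<noteq> 0" using n x(2) by (cases n) auto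
    then obtain m where m: "n = Suc m" by (cases n) auto
    have m': "(z ^^ m) x0 \<le> x"
      using not_less_Least[of m "\<lambda>n. x < (z ^^ n) x0"] m unfolding n_def by auto
    have "h x \<le> h ((z ^^ n) x0)" using n centralizesD(1)[OF h] by simp
    also have "\<dots> = (z ^^ n) (h x0)" using centralizesD(3)[OF h x0] .
    also have "\<dots> \<le> (z ^^ n) ((z ^^ N) x0)" by (rule mono_zpow[OF N(1)])
    also have "\<dots> = (z ^^ Suc N) ((z ^^ m) x0)"
      unfolding zpow_add[symmetric] m by (simp add: add.commute)
    also have "\<dots> \<le> (z ^^ Suc N) x" by (rule mono_zpow[OF m'])
    finally have 1: "h x \<le> (z ^^ Suc N) x" .
    have "x \<le> (z ^^ n) x0" using n by simp
    also have "\<dots> \<le> (z ^^ n) ((z ^^ N) (h x0))" by (rule mono_zpow[OF N(2)])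
    also have "\<dots> = (z ^^ Suc N) ((z ^^ m) (h x0))"
      unfolding zpow_add[symmetric] m by (simp add: add.commute)
    also have "\<dots> = (z ^^ Suc N) (h ((z ^^ m) x0))" using centralizesD(3)[OF h x0] by simp
    also have "\<dots> \<le> (z ^^ Suc N) (h x)" using mono_zpow centralizesD(1)[OF h m'] by blast
    finally show ?thesis using 1 by blast
  qed
  \<comment> \<open>Points below \<open>x0\<close> are pushed above it by a power of
    \<open>z\<close>; that power commutes with everything in the bound and reflects the order, so it
    cancels.\<close>
  have "h x \<le> (z ^^ Suc N) x \<and> x \<le> (z ^^ Suc N) (h x)" if x: "x \<in> X" for x
  proof -
    obtain m where m: "x0 < (z ^^ m) x" using cofinal[OF x x0] by blast
    have "h ((z ^^ m) x) \<le> (z ^^ Suc N) ((z ^^ m) x) \<and> (z ^^ m) x \<le> (z ^^ Suc N) (h ((z ^^ m) x))"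
      using ge[OF zpow_in[OF x]] m by simp
    then have "(z ^^ m) (h x) \<le> (z ^^ m) ((z ^^ Suc N) x) \<and> (z ^^ m) x \<le> (z ^^ m) ((z ^^ Suc N) (h x))"
      unfolding centralizesD(3)[OF h x] zpow_add[symmetric] by (simp only: add.commute)
    then show ?thesis unfolding zpow_le_iff .
  qed
  then show ?thesis unfolding dominated_def by blast
qed

lemma dominated_comp:
  assumes "dominated g A" "dominated h B" "centralizes g" "centralizes h"
  shows "dominated (g \<circ> h) (A + B)"
  unfolding dominated_def
proof (intro ballI conjI)
  fix x assume x: "x \<in> X"
  note hx = centralizesD(2)[OF assms(4) x]
  have "g (h x) \<le> (z ^^ A) (h x)" using assms(1) hx by (simp add: dominated_def)
  also have "\<dots> \<le> (z ^^ A) ((z ^^ B) x)" using assms(2) x mono_zpow by (simp add: dominated_def)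
  finally show "(g \<circ> h) x \<le> (z ^^ (A + B)) x" by (simp add: zpow_add)
  have "x \<le> (z ^^ B) (h x)" using assms(2) x by (simp add: dominated_def)
  also have "\<dots> \<le> (z ^^ B) ((z ^^ A) (g (h x)))"
    using assms(1) hx mono_zpow by (simp add: dominated_def)
  finally show "x \<le> (z ^^ (A + B)) ((g \<circ> h) x)" by (simp add: zpow_add[symmetric] add.commute)
qed

lemma dominated_funpow:
  assumes "dominated h C" "centralizes h"
  shows "dominated (h ^^ n) (C * n)"
proof (induction n)
  case 0
  then show ?case by (simp add: dominated_def)
next
  case (Suc n)
  show ?case
    unfolding funpow.simps(2) mult_Suc_right
    by (rule dominated_comp[OF assms(1) Suc assms(2) centralizes_funpow[OF assms(2)]])
qed

lemma funpow_commute_on: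
  assumes "\<And>x. x \<in> X \<Longrightarrow> g x \<in> X" "\<And>x. x \<in> X \<Longrightarrow> h x \<in> X"
    and "\<And>x. x \<in> X \<Longrightarrow> g (h x) = h (g x)" "x \<in> X"
  shows "g ((h ^^ n) x) = (h ^^ n) (g x)"
proof -
  have "(h ^^ n) x \<in> X" for n by (induction n) (auto simp: assms)
  then show ?thesis by (induction n) (auto simp: assms)
qed

text \<open>Each of the \<open>n\<close> copies of \<open>g\<close> passes each of the
  \<open>m\<close> copies of \<open>h\<close> at the price of one \<open>c\<close>, and
  \<open>c\<close> can be moved to the front because it commutes with both on
  \<open>X\<close>.\<close>

lemma heisenberg_funpow:
  assumes X: "\<And>x. x \<in> X \<Longrightarrow> g x \<in> X" "\<And>x. x \<in> X \<Longrightarrow> h x \<in> X" "\<And>x. x \<in> X \<Longrightarrow> c x \<in> X"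
    and cg: "\<And>x. x \<in> X \<Longrightarrow> g (c x) = c (g x)" and ch: "\<And>x. x \<in> X \<Longrightarrow> h (c x) = c (h x)"
    and gh: "\<And>x. x \<in> X \<Longrightarrow> g (h x) = c (h (g x))" and x: "x \<in> X"
  shows "(g ^^ n) ((h ^^ m) x) = (c ^^ (n * m)) ((h ^^ m) ((g ^^ n) x))"
proof -
  have inX: "(g ^^ k) y \<in> X" "(h ^^ k) y \<in> X" "(c ^^ k) y \<in> X" if "y \<in> X" for k y
    using that X by (induction k) auto
  have gc: "g ((c ^^ k) y) = (c ^^ k) (g y)" "h ((c ^^ k) y) = (c ^^ k) (h y)" if "y \<in> X" for k y
    using that funpow_commute_on X cg ch by metis+
  have one: "(g ^^ n) (h y) = (c ^^ n) (h ((g ^^ n) y))" if "y \<in> X" for y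
  proof (induction n)
    case (Suc n)
    then show ?case using that inX X by (simp add: gc gh funpow_swap1)
  qed simp
  show ?thesis
  proof (induction m)
    case (Suc m)
    have "(g ^^ n) ((h ^^ Suc m) x) = (c ^^ n) (h ((g ^^ n) ((h ^^ m) x)))"
      using one inX x by simp
    also have "\<dots> = (c ^^ n) ((c ^^ (n * m)) (h ((h ^^ m) ((g ^^ n) x))))"
      using Suc gc inX x by simp
    finally show ?case by (simp add: funpow_add)
  qed simp
qed

text \<open>Both \<open>g ^^ n\<close> after \<open>h ^^ n\<close> and \<open>h ^^ n\<close> after
  \<open>g ^^ n\<close> are dominated linearly in \<open>n\<close>, while they differ by exactly
  \<open>c ^^ (n * n)\<close>.\<close>

lemma slow_commutator:
  assumes cen: "centralizes g" "centralizes h" "centralizes c"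
    and cg: "\<And>x. x \<in> X \<Longrightarrow> g (c x) = c (g x)" and ch: "\<And>x. x \<in> X \<Longrightarrow> h (c x) = c (h x)"
    and gh: "\<And>x. x \<in> X \<Longrightarrow> g (h x) = c (h (g x))"
  shows "slow c"
proof -
  obtain A B where A: "dominated g A" and B: "dominated h B"
    using centralizes_dominated cen by blast
  have "dominated (c ^^ (n * n)) ((2 * (A + B)) * n)" for n
    unfolding dominated_def
  proof (intro ballI conjI)
    fix x assume x: "x \<in> X"
    let ?k = "(A + B) * n"
    let ?c = "c ^^ (n * n)" and ?gh = "(g ^^ n) \<circ> (h ^^ n)" and ?hg = "(h ^^ n) \<circ> (g ^^ n)"
    note cp = centralizes_funpow[OF cen(1), of n] centralizes_funpow[OF cen(2), of n]
      centralizes_funpow[OF cen(3), of "n * n"]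
    have d1: "dominated ?gh ?k" and d2: "dominated ?hg ?k"
      using dominated_comp[OF dominated_funpow[OF A cen(1)] dominated_funpow[OF B cen(2)] cp(1,2)]
        dominated_comp[OF dominated_funpow[OF B cen(2)] dominated_funpow[OF A cen(1)] cp(2,1)]
      by (auto simp: algebra_simps)
    have eq: "?gh x = ?c (?hg x)"
      using heisenberg_funpow[of g h c x n n] cen cg ch gh x by (auto simp: centralizes_def)
    have hgx: "?hg x \<in> X" using cp x centralizesD(2) by auto
    have "2 * (A + B) * n = ?k + ?k" by (simp add: algebra_simps)
    then have two: "(z ^^ (2 * (A + B) * n)) y = (z ^^ ?k) ((z ^^ ?k) y)" for y
      using zpow_add[of ?k ?k y] by presburger
    have "?c x \<le> ?c ((z ^^ ?k) (?hg x))"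
      using d2 x centralizesD(1)[OF cp(3)] by (auto simp: dominated_def)
    also have "\<dots> = (z ^^ ?k) (?gh x)" using centralizesD(3)[OF cp(3) hgx] eq by simp
    also have "\<dots> \<le> (z ^^ ?k) ((z ^^ ?k) x)"
      by (rule mono_zpow) (use d1 x in \<open>auto simp: dominated_def\<close>)
    finally show "?c x \<le> (z ^^ (2 * (A + B) * n)) x" unfolding two .
    have "x \<le> (z ^^ ?k) (?gh x)" using d1 x by (auto simp: dominated_def)
    also have "\<dots> = (z ^^ ?k) (?c (?hg x))" by (simp only: eq)
    also have "\<dots> \<le> (z ^^ ?k) (?c ((z ^^ ?k) x))"
      by (intro mono_zpow centralizesD(1)[OF cp(3)]) (use d2 x in \<open>auto simp: dominated_def\<close>)
    also have "\<dots> = (z ^^ ?k) ((z ^^ ?k) (?c x))" using centralizesD(3)[OF cp(3) x] by simp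
    finally show "x \<le> (z ^^ (2 * (A + B) * n)) (?c x)" unfolding two .
  qed
  then show ?thesis unfolding slow_def by blast
qed

lemma slow_id: "slow id"
  unfolding slow_def by (rule exI[of _ 0]) (simp add: dominated_def)

text \<open>Needed because elements of a commutator subgroup are products of commutators.
  Commutation on \<open>X\<close> splits the powers of \<open>c \<circ> d\<close>, and the two
  linear bounds add up.\<close>

lemma slow_comp:
  assumes "slow c" "slow d" "centralizes c" "centralizes d"
    and comm: "\<And>x. x \<in> X \<Longrightarrow> c (d x) = d (c x)"
  shows "slow (c \<circ> d)"
proof -
  obtain C D where C: "\<And>n. dominated (c ^^ (n * n)) (C * n)" and D: "\<And>n. dominated (d ^^ (n * n)) (D * n)"
    using assms(1,2) unfolding slow_def by blast
  have X: "\<And>x. x \<in> X \<Longrightarrow> c x \<in> X" "\<And>x. x \<in> X \<Longrightarrow> d x \<in> X"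
    using assms(3,4) by (auto simp: centralizes_def)
  have eq: "((c \<circ> d) ^^ k) x = (c ^^ k) ((d ^^ k) x)" if "x \<in> X" for k x
  proof (induction k)
    case (Suc k)
    have "(d ^^ k) x \<in> X" using X that by (induction k) auto
    then have "d ((c ^^ k) ((d ^^ k) x)) = (c ^^ k) (d ((d ^^ k) x))"
      using funpow_commute_on[of d c "(d ^^ k) x" k] X comm by auto
    with Suc show ?case by simp
  qed simp
  have "dominated ((c \<circ> d) ^^ (n * n)) ((C + D) * n)" for n
    using dominated_comp[OF C D centralizes_funpow[OF assms(3)] centralizes_funpow[OF assms(4)], of n n]
    by (simp add: dominated_def eq algebra_simps)
  then show ?thesis unfolding slow_def by blast
qed

lemma not_slow_z:
  assumes "X \<noteq> {}" shows "\<not> slow z"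
proof
  assume "slow z"
  then obtain C where C: "\<And>n. dominated (z ^^ (n * n)) (C * n)" unfolding slow_def by blast
  obtain x where x: "x \<in> X" using assms by blast
  \<comment> \<open>At \<open>n = C + 1\<close> the square \<open>n * n\<close> exceeds
    \<open>C * n\<close>.\<close>
  let ?k = "C * Suc C"
  have "(z ^^ (Suc C * Suc C)) x \<le> (z ^^ ?k) x" using C[of "Suc C"] x by (simp add: dominated_def)
  moreover have "(z ^^ Suc ?k) x \<le> (z ^^ (Suc C * Suc C)) x" by (rule zpow_le_zpow[OF x]) simp
  moreover have "(z ^^ ?k) x < (z ^^ Suc ?k) x" using less_z[OF zpow_in[OF x]] by simp
  ultimately show False by auto
qed

end

subsection \<open>Fixed points in nilpotent groups of increasing maps\<close>

text \<open>A bounded orbit would increase to a fixed point of \<open>f\<close>, which lies in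
  \<open>X\<close> because it is between \<open>x\<close> and the bound \<open>y\<close>.\<close>

lemma cofinal_map_interval:
  fixes f :: "real \<Rightarrow> real"
  assumes f: "strict_mono f" "continuous_on UNIV f" and X: "is_interval X"
    and into: "\<And>x. x \<in> X \<Longrightarrow> f x \<in> X" and less: "\<And>x. x \<in> X \<Longrightarrow> x < f x"
  shows "cofinal_map f X"
proof
  fix x y assume x: "x \<in> X" and y: "y \<in> X"
  show "\<exists>n. y < (f ^^ n) x"
  proof (rule ccontr)
    assume "\<not> ?thesis"
    then have le: "(f ^^ n) x \<le> y" for n by (simp add: not_less)
    have inX: "(f ^^ n) x \<in> X" for n by (induction n) (auto simp: x into)
    have inc: "incseq (\<lambda>n. (f ^^ n) x)"
      by (rule incseq_SucI) (use less[OF inX] in \<open>auto intro: less_imp_le\<close>)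
    obtain L where L: "(\<lambda>n. (f ^^ n) x) \<longlonglongrightarrow> L" "\<And>n. (f ^^ n) x \<le> L"
      using incseq_convergent[OF inc, of y] le by blast
    have "(\<lambda>n. f ((f ^^ n) x)) \<longlonglongrightarrow> f L"
      using continuous_on_tendsto_compose[OF f(2) L(1)] by simp
    moreover have "(\<lambda>n. f ((f ^^ n) x)) \<longlonglongrightarrow> L" using LIMSEQ_Suc[OF L(1)] by simp
    ultimately have "f L = L" using LIMSEQ_unique by blast
    moreover have "L \<le> y" using LIMSEQ_le_const2[OF L(1)] le by blast
    then have "L \<in> X" using mem_is_interval_1_I[OF X x y] L(2)[of 0] by simp
    ultimately show False using less by fastforce
  qed
qed (fact f(1) into)+

lemma cofinal_map_subset:
  assumes "cofinal_map z X" "Y \<subseteq> X" "\<And>x. x \<in> Y \<Longrightarrow> z x \<in> Y"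
  shows "cofinal_map z Y"
proof -
  interpret cofinal_map z X by fact
  show ?thesis
  proof
    show "strict_mono z" by (fact mono_z)
    show "z x \<in> Y" if "x \<in> Y" for x using that by (fact assms(3))
    show "\<exists>n. y < (z ^^ n) x" if "x \<in> Y" "y \<in> Y" for x y
      using cofinal that assms(2) by (meson subsetD)
  qed
qed

lemma no_fixed_point_less:
  fixes f :: "real \<Rightarrow> real"
  assumes f: "continuous_on UNIV f" and X: "is_interval X" "\<And>x. x \<in> X \<Longrightarrow> f x \<noteq> x"
    and a: "a \<in> X" "a < f a" and x: "x \<in> X"
  shows "x < f x"
proof (rule ccontr)
  assume "\<not> x < f x"
  then have le: "f x - x \<le> 0" by simp
  have cont: "continuous_on S (\<lambda>t. f t - t)" for S
    by (intro continuous_intros continuous_on_subset[OF f]) auto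
  obtain t where "t \<in> X" "f t - t = 0"
  proof (cases "a \<le> x")
    case True
    then obtain t where "a \<le> t" "t \<le> x" "f t - t = 0"
      using IVT2'[of "\<lambda>t. f t - t" x 0 a] le a(2) cont by auto
    then show ?thesis using that mem_is_interval_1_I[OF X(1) a(1) x] by blast
  next
    case False
    then obtain t where "x \<le> t" "t \<le> a" "f t - t = 0"
      using IVT'[of "\<lambda>t. f t - t" x 0 a] le a(2) cont by auto
    then show ?thesis using that mem_is_interval_1_I[OF X(1) x a(1)] by blast
  qed
  then show False using X(2) by force
qed

text \<open>Since \<open>y\<close> is fixed, \<open>z\<close> and its right inverse \<open>w\<close>
  both preserve the part of \<open>A\<close> below \<open>y\<close>. Neither can raise the supremum
  of that part, so the supremum is fixed.\<close>

lemma closed_invariant_fixed_point: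
  fixes z :: "real \<Rightarrow> real"
  assumes A: "closed A" and low: "\<exists>a\<in>A. a \<le> y"
    and mono: "strict_mono z" and inv: "\<And>x. z (w x) = x"
    and zA: "\<And>x. x \<in> A \<Longrightarrow> z x \<in> A" and wA: "\<And>x. x \<in> A \<Longrightarrow> w x \<in> A"
    and y: "z y = y"
  shows "\<exists>p\<in>A. z p = p"
proof -
  define B where "B = {x\<in>A. x \<le> y}"
  have B: "B \<noteq> {}" "bdd_above B" using low by (auto simp: B_def)
  have "closed B"
    using closed_Int[OF A closed_atMost[of y]] by (simp add: B_def Int_def)
  then have p: "Sup B \<in> B" using closed_contains_Sup B by blast
  have zB: "z x \<in> B" if "x \<in> B" for x
    using that zA strict_mono_less_eq[OF mono, of x y] y by (auto simp: B_def)
  have wB: "w x \<in> B" if "x \<in> B" for x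
    using that wA strict_mono_less_eq[OF mono, of "w x" y] y inv by (auto simp: B_def)
  have "z (Sup B) \<le> Sup B" using cSup_upper[OF zB[OF p] B(2)] .
  moreover have "w (Sup B) \<le> Sup B" using cSup_upper[OF wB[OF p] B(2)] .
  then have "Sup B \<le> z (Sup B)" using strict_mono_less_eq[OF mono, of "w (Sup B)" "Sup B"] inv by simp
  ultimately show ?thesis using p by (auto simp: B_def intro!: bexI[of _ "Sup B"])
qed

text \<open>A point of \<open>A\<close> is moved below \<open>x0\<close> by \<open>w\<close> and
  then up again by \<open>e\<close>; the first iterate beyond \<open>x0\<close> has not yet passed
  \<open>e x0\<close>.\<close>

lemma invariant_meets_fundamental_domain:
  fixes e :: "real \<Rightarrow> real"
  assumes e: "cofinal_map e UNIV" and inv: "\<And>x. e (w x) = x"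
    and eA: "\<And>x. x \<in> A \<Longrightarrow> e x \<in> A" and wA: "\<And>x. x \<in> A \<Longrightarrow> w x \<in> A" and ne: "A \<noteq> {}"
  shows "\<exists>b\<in>A. x0 \<le> b \<and> b \<le> e x0"
proof -
  interpret cofinal_map e UNIV by (rule e)
  obtain a where a: "a \<in> A" using ne by blast
  obtain n where n: "a < (e ^^ n) x0" using cofinal by blast
  have wn: "(w ^^ n) a \<in> A" for n by (induction n) (auto simp: a wA)
  have en: "(e ^^ n) x \<in> A" if "x \<in> A" for n x using that by (induction n) (auto simp: eA)
  define b where "b = (w ^^ n) a"
  have "(e ^^ n) ((w ^^ n) x) = x" for n x
  proof (induction n)
    case (Suc n)
    have "(e ^^ Suc n) ((w ^^ Suc n) x) = (e ^^ n) (e (w ((w ^^ n) x)))"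
      by (simp add: funpow_swap1)
    then show ?case using Suc inv by simp
  qed simp
  then have "(e ^^ n) b \<le> (e ^^ n) x0" using n by (simp add: b_def)
  then have b: "b \<le> x0" "b \<in> A" using zpow_le_iff wn by (auto simp: b_def)
  define m where "m = (LEAST m. x0 < (e ^^ m) b)"
  have m: "x0 < (e ^^ m) b" unfolding m_def using cofinal[of b x0] by (auto intro: LeastI_ex)
  then have "m \<noteq> 0" using b(1) by (cases m) auto
  then obtain k where k: "m = Suc k" by (cases m) auto
  have "(e ^^ k) b \<le> x0" using not_less_Least[of k "\<lambda>m. x0 < (e ^^ m) b"] k unfolding m_def by auto
  then have "(e ^^ m) b \<le> e x0" using mono_zpow[of _ _ 1] k by simp
  then show ?thesis using less_imp_le[OF m] en[OF b(2), of m] by (intro bexI conjI)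
qed

section \<open>Normality of the lower central series\<close>

declare lower_central_series.simps(2) [simp del]

context group
begin

lemma commutator_closed:
  assumes "N \<lhd> G" "h \<in> carrier G" "k \<in> N"
  shows "h \<otimes> k \<otimes> inv h \<otimes> inv k \<in> N"
  using assms normal.inv_op_closed2[OF assms(1)]
  by (meson normal_imp_subgroup subgroup.m_closed subgroup.m_inv_closed)

text \<open>A conjugate of a commutator is the commutator of the conjugates, so the generating set
  is already invariant under conjugation.\<close>

lemma commutator_subgroup_normal:
  assumes N: "N \<lhd> G"
  shows "commutator_subgroup G (carrier G) N \<lhd> G"
  unfolding commutator_subgroup_def
proof (rule normal_generateI)
  have NG: "N \<subseteq> carrier G" using N by (simp add: normal_imp_subgroup subgroup.subset)
  then show "(\<Union>h\<in>carrier G. \<Union>k\<in>N. {h \<otimes> k \<otimes> inv h \<otimes> inv k}) \<subseteq> carrier G" by auto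
  fix c g assume "c \<in> (\<Union>h\<in>carrier G. \<Union>k\<in>N. {h \<otimes> k \<otimes> inv h \<otimes> inv k})" and g: "g \<in> carrier G"
  then obtain h k where h: "h \<in> carrier G" and k: "k \<in> N" and c: "c = h \<otimes> k \<otimes> inv h \<otimes> inv k"
    by auto
  let ?h = "g \<otimes> h \<otimes> inv g" and ?k = "g \<otimes> k \<otimes> inv g"
  have kG: "k \<in> carrier G" using k NG by blast
  have canc: "inv g \<otimes> (g \<otimes> x) = x" if "x \<in> carrier G" for x
    using that g by (simp add: m_assoc[symmetric])
  have "g \<otimes> c \<otimes> inv g = ?h \<otimes> ?k \<otimes> inv ?h \<otimes> inv ?k"
    unfolding c using g h kG by (simp add: inv_mult_group m_assoc canc)
  moreover have "?h \<in> carrier G" "?k \<in> N" using g h normal.inv_op_closed2[OF N g k] by auto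
  ultimately show "g \<otimes> c \<otimes> inv g \<in> (\<Union>h\<in>carrier G. \<Union>k\<in>N. {h \<otimes> k \<otimes> inv h \<otimes> inv k})" by blast
qed

lemma lower_central_series_normal: "lower_central_series G n \<lhd> G"
  by (induction n)
    (auto simp: lower_central_series.simps(2) commutator_subgroup_normal normal_invI subgroup_self)

lemma lower_central_series_subgroup: "subgroup (lower_central_series G n) G"
  by (rule normal_imp_subgroup[OF lower_central_series_normal])

lemma lower_central_series_subset: "lower_central_series G n \<subseteq> carrier G"
  by (rule subgroup.subset[OF lower_central_series_subgroup])

lemma lower_central_series_Suc_subset:
  "lower_central_series G (Suc n) \<subseteq> lower_central_series G n"
  unfolding lower_central_series.simps commutator_subgroup_def
  by (rule generate_subgroup_incl[OF _ lower_central_series_subgroup])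
    (use commutator_closed[OF lower_central_series_normal] in blast)

lemma commutator_in_lower_central_series:
  assumes "h \<in> carrier G" "k \<in> lower_central_series G n"
  shows "h \<otimes> k \<otimes> inv h \<otimes> inv k \<in> lower_central_series G (Suc n)"
  using assms unfolding lower_central_series.simps commutator_subgroup_def
  by (intro generate.incl) blast

end

text \<open>Smoothness is absent here: the locale is used both for \<open>Diff2R\<close> and for the
  nilpotent subgroup, where only the order on the line matters.\<close>

locale increasing_group = group G for G :: "(real \<Rightarrow> real) monoid" (structure) +
  assumes mult_eq: "x \<otimes> y = x \<circ> y"
    and one_eq: "\<one> = id"
    and strict_mono: "f \<in> carrier G \<Longrightarrow> strict_mono f"
begin

lemma inv_apply [simp]:
  assumes "f \<in> carrier G"
  shows "(inv f) (f x) = x" "f ((inv f) x) = x"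
  using l_inv[OF assms] r_inv[OF assms] unfolding mult_eq one_eq by (auto dest: fun_cong)

text \<open>Continuity is automatic for an increasing bijection of the line.\<close>

lemma continuous:
  assumes f: "f \<in> carrier G"
  shows "continuous_on UNIV f"
proof (rule continuous_onI_mono)
  have "range f = UNIV" using inv_apply(2)[OF f] by (metis surj_def)
  then show "open (range f)" by simp
qed (use strict_mono[OF f] in \<open>simp add: strict_mono_less_eq\<close>)

lemma inv_eq_iff:
  assumes "f \<in> carrier G"
  shows "(inv f) x = y \<longleftrightarrow> x = f y"
  using assms by auto

lemma inv_less_iff:
  assumes "f \<in> carrier G"
  shows "x < (inv f) x \<longleftrightarrow> f x < x"
  using assms strict_mono_less[OF strict_mono[OF assms], of x "(inv f) x"] by simp

lemma closed_fixed:
  assumes "f \<in> carrier G" shows "closed {x. f x = x}"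
  by (rule closed_Collect_eq) (use continuous[OF assms] in \<open>auto intro: continuous_on_id\<close>)

text \<open>Pointwise Heisenberg relations: the inverse of the commutator satisfies the same
  relation with \<open>g\<close> and \<open>h\<close> exchanged.\<close>

lemma commutator_apply:
  assumes "g \<in> carrier G" "h \<in> carrier G"
  shows "(g \<otimes> h \<otimes> inv g \<otimes> inv h) (h (g x)) = g (h x)"
    and "(inv (g \<otimes> h \<otimes> inv g \<otimes> inv h)) (g (h x)) = h (g x)"
  using assms by (simp_all add: mult_eq[symmetric] inv_eq_iff) (simp_all add: mult_eq)

text \<open>By the intermediate value theorem \<open>f\<close> moves all points in one direction;
  \<open>e\<close> is \<open>f\<close> or its inverse, whichever moves them up.\<close>

lemma fixed_point_free_cofinal:
  assumes K: "subgroup K G" and f: "f \<in> K" "\<And>x. f x \<noteq> x"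
  obtains (elem) e where "e \<in> K" "cofinal_map e UNIV"
proof -
  have *: thesis if g: "g \<in> K" "\<And>x. g x \<noteq> x" "0 < g 0" for g
  proof -
    have gG: "g \<in> carrier G" using subgroup.mem_carrier[OF K] g by blast
    have "x < g x" for x
      using no_fixed_point_less[OF continuous[OF gG] is_interval_univ, of 0 x] g by simp
    then have "cofinal_map g UNIV"
      using cofinal_map_interval[OF strict_mono[OF gG] continuous[OF gG] is_interval_univ] by simp
    then show thesis using elem g by blast
  qed
  have fG: "f \<in> carrier G" using subgroup.mem_carrier[OF K] f by blast
  show thesis
  proof (cases "0 < f 0")
    case True
    then show ?thesis using * f by blast
  next
    case False
    then have "f 0 < 0" using f(2)[of 0] by linarith
    then show ?thesis
      using *[of "inv f"] subgroup.m_inv_closed[OF K] f inv_less_iff[OF fG] inv_eq_iff[OF fG] by metis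
  qed
qed

section \<open>Common fixed points along the lower central series\<close>

definition common_fixed :: "nat \<Rightarrow> real set" where
  "common_fixed n = {x. \<forall>h\<in>lower_central_series G n. h x = x}"

lemma common_fixed_invariant:
  assumes x: "x \<in> common_fixed n" and g: "g \<in> carrier G"
  shows "g x \<in> common_fixed n"
  unfolding common_fixed_def
proof safe
  fix h assume h: "h \<in> lower_central_series G n"
  then have "inv g \<otimes> h \<otimes> g \<in> lower_central_series G n"
    using normal.inv_op_closed1[OF lower_central_series_normal g] by blast
  then have "(inv g) (h (g x)) = x" using x by (auto simp: common_fixed_def mult_eq)
  then show "h (g x) = g x" using inv_eq_iff[OF g] by simp
qed

text \<open>The commutator of \<open>g\<close> and \<open>z\<close> lies in the next term, which
  fixes these points: here term \<open>n\<close> acts as if it were central.\<close>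

lemma commute_on_common_fixed:
  assumes x: "x \<in> common_fixed (Suc n)" and z: "z \<in> lower_central_series G n" and g: "g \<in> carrier G"
  shows "g (z x) = z (g x)"
proof -
  have zG: "z \<in> carrier G" using lower_central_series_subset z by blast
  have "(g \<otimes> z \<otimes> inv g \<otimes> inv z) (z (g x)) = z (g x)"
    using commutator_in_lower_central_series[OF g z]
      common_fixed_invariant[OF common_fixed_invariant[OF x g] zG] by (simp add: common_fixed_def)
  then show ?thesis using commutator_apply[OF g zG] by simp
qed

text \<open>Otherwise some \<open>e\<close> in \<open>?K\<close> is cofinal. On \<open>?X\<close>
  the elements of \<open>?K\<close> act centrally, so the commutators generating \<open>?K\<close>
  are slow relative to \<open>e\<close>, hence so is all of \<open>?K\<close>, including
  \<open>e\<close> itself. The index \<open>Suc m\<close> makes \<open>?K\<close> a commutator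
  subgroup.\<close>

lemma fixed_point_if_common_fixed:
  assumes ne: "common_fixed (Suc (Suc m)) \<noteq> {}" and z: "z \<in> lower_central_series G (Suc m)"
  shows "\<exists>x. z x = x"
proof (rule ccontr)
  let ?K = "lower_central_series G (Suc m)" and ?X = "common_fixed (Suc (Suc m))"
  assume "\<not> ?thesis"
  then obtain e where e: "e \<in> ?K" "cofinal_map e UNIV"
    using fixed_point_free_cofinal[OF lower_central_series_subgroup z] by blast
  have eG: "e \<in> carrier G" using lower_central_series_subset e by blast
  interpret cofinal_map e ?X
    by (rule cofinal_map_subset[OF e(2)]) (use common_fixed_invariant[OF _ eG] in auto)
  have cen: "centralizes g" if "g \<in> carrier G" for g
    unfolding centralizes_def
    using that strict_mono[OF that] commute_on_common_fixed[OF _ e(1) that]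
    by (auto intro: common_fixed_invariant strict_mono_mono)
  have K: "c \<in> carrier G" "\<And>g x. g \<in> carrier G \<Longrightarrow> x \<in> ?X \<Longrightarrow> g (c x) = c (g x)" if "c \<in> ?K" for c
    using that lower_central_series_subset commute_on_common_fixed by blast+
  have com: "slow c" if "c \<in> ?K" "g \<in> carrier G" "h \<in> carrier G" "\<And>x. g (h x) = c (h (g x))" for c g h
    by (rule slow_commutator[of g h c]) (use that cen K in auto)
  have "slow c" if "c \<in> ?K" for c
    using that unfolding lower_central_series.simps(2)[of G m] commutator_subgroup_def
  proof (induction rule: generate.induct)
    case one
    show ?case unfolding one_eq by (rule slow_id)
  next
    case (incl c)
    then obtain g h where gh: "g \<in> carrier G" "h \<in> lower_central_series G m"
      and c: "c = g \<otimes> h \<otimes> inv g \<otimes> inv h" by auto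
    have hG: "h \<in> carrier G" using lower_central_series_subset gh by blast
    show ?case
      using com[of c g h] commutator_in_lower_central_series[OF gh] gh hG
        commutator_apply(1)[OF gh(1) hG] c by metis
  next
    case (inv c)
    then obtain g h where gh: "g \<in> carrier G" "h \<in> lower_central_series G m"
      and c: "c = g \<otimes> h \<otimes> inv g \<otimes> inv h" by auto
    have hG: "h \<in> carrier G" using lower_central_series_subset gh by blast
    have "inv c \<in> ?K"
      using commutator_in_lower_central_series[OF gh] c
        subgroup.m_inv_closed[OF lower_central_series_subgroup] by blast
    then show ?case
      using com[of "inv c" h g] gh hG commutator_apply(2)[OF gh(1) hG] c by metis
  next
    case (eng c d)
    then have cd: "c \<in> ?K" "d \<in> ?K"
      by (auto simp: lower_central_series.simps(2) commutator_subgroup_def)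
    show ?case
      unfolding mult_eq by (rule slow_comp[OF eng.IH]) (use cen K cd in auto)
  qed
  then show False using not_slow_z[OF ne] e(1) by blast
qed

text \<open>The fixed-point-free element \<open>e\<close> makes the invariant closed sets in question meet one
  compact fundamental domain, so that they satisfy the finite intersection property.\<close>

lemma common_fixed_descend:
  assumes e: "e \<in> carrier G" "cofinal_map e UNIV"
    and ne: "common_fixed (Suc (Suc m)) \<noteq> {}"
  shows "common_fixed (Suc m) \<noteq> {}"
proof -
  let ?K = "lower_central_series G (Suc m)" and ?X = "common_fixed (Suc (Suc m))"
  define A where "A S = {x\<in>?X. \<forall>z\<in>S. z x = x}" for S
  note KG = subsetD[OF lower_central_series_subset]
  have "closed (\<Inter>h\<in>S. {x. h x = x})" if "S \<subseteq> carrier G" for S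
    using that closed_fixed by (intro closed_INT) blast
  then have clX: "closed ?X" and cl: "\<And>S. S \<subseteq> ?K \<Longrightarrow> closed (\<Inter>h\<in>S. {x. h x = x})"
    using lower_central_series_subset[of "Suc (Suc m)"] lower_central_series_subset[of "Suc m"]
    by (auto simp: common_fixed_def Collect_ball_eq)
  have clA: "closed (A S)" if "S \<subseteq> ?K" for S
    using closed_Int[OF clX cl[OF that]] by (simp add: A_def Int_def)
  \<comment> \<open>Elements of \<open>S\<close> act centrally on \<open>?X\<close>, so the whole
    group preserves their fixed points there.\<close>
  have invA: "g x \<in> A S" if "S \<subseteq> ?K" "x \<in> A S" "g \<in> carrier G" for S x g
    using that common_fixed_invariant[of x _ g] commute_on_common_fixed[of x "Suc m" _ g]
    by (fastforce simp: A_def)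
  have meets: "\<exists>b\<in>A S. x0 \<le> b \<and> b \<le> e x0" if "S \<subseteq> ?K" "A S \<noteq> {}" for S x0
    by (rule invariant_meets_fundamental_domain[OF e(2), of "inv e"]) (use that invA e in auto)
  have neA: "A S \<noteq> {}" if "finite S" "S \<subseteq> ?K" for S
    using that
  proof (induction S rule: finite_induct)
    case empty
    show ?case using ne by (simp add: A_def)
  next
    case (insert z S)
    then have z: "z \<in> carrier G" "S \<subseteq> ?K" "A S \<noteq> {}" using KG by auto
    obtain y where y: "z y = y" using fixed_point_if_common_fixed[OF ne] insert.prems by blast
    \<comment> \<open>The fundamental domain is started at the preimage of \<open>y\<close> so that
      it ends at \<open>y\<close>.\<close>
    have "\<exists>b\<in>A S. b \<le> y" using meets[OF z(2,3), of "(inv e) y"] e(1) by auto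
    then have "\<exists>p\<in>A S. z p = p"
      using closed_invariant_fixed_point[OF clA[OF z(2)] _ strict_mono[OF z(1)] inv_apply(2)[OF z(1)] _ _ y]
        invA z by auto
    then show ?case by (auto simp: A_def)
  qed
  have "{0..e 0} \<inter> (\<Inter>z\<in>?K. A {z}) \<noteq> {}"
  proof (rule compact_imp_fip_image)
    fix S assume S: "finite S" "S \<subseteq> ?K"
    obtain b where "b \<in> A S" "0 \<le> b" "b \<le> e 0" using meets[OF S(2) neA[OF S]] by blast
    then have "b \<in> {0..e 0} \<inter> (\<Inter>z\<in>S. A {z})" by (auto simp: A_def)
    then show "{0..e 0} \<inter> (\<Inter>z\<in>S. A {z}) \<noteq> {}" by blast
  qed (use clA in auto)
  then show ?thesis by (auto simp: A_def common_fixed_def)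
qed

text \<open>A fixed-point-free element would allow a descent from term \<open>n\<close>, whose fixed
  point set is the whole line, to term 1, giving a point fixed by \<open>f\<close> after
  all.\<close>

lemma fixed_point_derived:
  assumes nil: "lower_central_series G n = {\<one>}" and f: "f \<in> lower_central_series G 1"
  shows "\<exists>x. f x = x"
proof (rule ccontr)
  assume nf: "\<not> ?thesis"
  then obtain e where e: "e \<in> lower_central_series G 1" "cofinal_map e UNIV"
    using fixed_point_free_cofinal[OF lower_central_series_subgroup f] by blast
  have eG: "e \<in> carrier G" using e(1) lower_central_series_subset by blast
  have "n \<noteq> 0"
  proof
    assume "n = 0"
    then have "f = \<one>" using nil f lower_central_series_subset[of 1] by auto
    then show False using nf by (simp add: one_eq)
  qed
  then have "1 \<le> n" by simp
  then have "common_fixed 1 \<noteq> {}"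
  proof (induction rule: inc_induct)
    case base
    show ?case using nil by (auto simp: common_fixed_def one_eq)
  next
    case (step k)
    then show ?case using common_fixed_descend[OF eG e(2), of "k - 1"] by auto
  qed
  then show False using f nf by (auto simp: common_fixed_def)
qed

end

subsection \<open>Kopell's lemma\<close>

interpretation Diff2R: increasing_group Diff2R
  by (intro increasing_group.intro increasing_group_axioms.intro group_Diff2R)
    (auto simp: Diff2R_def)

lemma Diff2R_funpow: "f \<in> carrier Diff2R \<Longrightarrow> f ^^ n \<in> carrier Diff2R"
proof (induction n)
  case 0
  show ?case using Diff2R.one_closed by (simp only: Diff2R.one_eq funpow.simps)
next
  case (Suc n)
  then show ?case using Diff2R.m_closed[of f "f ^^ n"] by (simp only: Diff2R.mult_eq funpow.simps)
qed

text \<open>Differentiating the identity that the inverse undoes \<open>f\<close> shows that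
  \<open>f'\<close> never vanishes; monotonicity then excludes a negative sign.\<close>

lemma Diff2R_derivE:
  assumes "f \<in> carrier Diff2R"
  obtains f' f'' where "\<And>x. (f has_real_derivative f' x) (at x)"
    "\<And>x. (f' has_real_derivative f'' x) (at x)" "continuous_on UNIV f''" "\<And>x. 0 < f' x"
proof -
  have f: "bij f" "C2_differentiable f" "C2_differentiable (inv_into UNIV f)" "strict_mono f"
    using assms by (auto simp: Diff2R_def)
  obtain f' where f': "\<And>x. (f has_real_derivative f' x) (at x)" "f' C1_differentiable_on UNIV"
    using f(2) unfolding C2_differentiable_def by blast
  obtain f'' where f'': "\<And>x. (f' has_real_derivative f'' x) (at x)" "continuous_on UNIV f''"
    using f'(2) unfolding C1_differentiable_on_def
    by (auto simp: has_real_derivative_iff_has_vector_derivative)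
  obtain g' where g': "\<And>x. (inv_into UNIV f has_real_derivative g' x) (at x)"
    using f(3) unfolding C2_differentiable_def by blast
  have "0 < f' x" for x
  proof -
    have "((\<lambda>x. inv_into UNIV f (f x)) has_real_derivative g' (f x) * f' x) (at x)"
      by (rule DERIV_chain2[OF g' f'(1)])
    then have "((\<lambda>x. x) has_real_derivative g' (f x) * f' x) (at x)"
      using f(1) by (simp add: bij_is_inj)
    then have "g' (f x) * f' x = 1" using DERIV_unique DERIV_ident by blast
    then have "f' x \<noteq> 0" by auto
    moreover have "\<not> f' x < 0"
    proof
      assume "f' x < 0"
      then obtain d where d: "0 < d" "\<And>h. 0 < h \<Longrightarrow> h < d \<Longrightarrow> f (x + h) < f x"
        using DERIV_neg_dec_right[OF f'(1)] by blast
      show False using d(2)[of "d / 2"] d(1) strict_monoD[OF f(4), of x "x + d / 2"] by simp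
    qed
    ultimately show ?thesis by linarith
  qed
  then show thesis using that f'(1) f'' by blast
qed

lemma DERIV_funpow:
  fixes f :: "real \<Rightarrow> real"
  assumes "\<And>x. (f has_real_derivative f' x) (at x)"
  shows "((f ^^ n) has_real_derivative (\<Prod>i<n. f' ((f ^^ i) x))) (at x)"
proof (induction n)
  case (Suc n)
  have "((\<lambda>x. f ((f ^^ n) x)) has_real_derivative f' ((f ^^ n) x) * (\<Prod>i<n. f' ((f ^^ i) x))) (at x)"
    by (rule DERIV_chain2[OF assms Suc])
  then show ?case by (simp add: o_def mult.commute)
qed (simp add: id_def)

text \<open>The second derivative enters here: \<open>ln (f' x)\<close> has derivative
  \<open>f'' x / f' x\<close>, which is bounded on a compact interval.\<close>

lemma ln_deriv_Lipschitz:
  fixes f' :: "real \<Rightarrow> real"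
  assumes f': "\<And>x. (f' has_real_derivative f'' x) (at x)" "\<And>x. 0 < f' x" and f'': "continuous_on UNIV f''"
  obtains L where "0 \<le> L" "\<And>u v. u \<in> {a..b} \<Longrightarrow> v \<in> {a..b} \<Longrightarrow> \<bar>ln (f' u) - ln (f' v)\<bar> \<le> L * \<bar>u - v\<bar>"
proof -
  have "continuous_on {a..b} (\<lambda>x. f'' x / f' x)"
    by (intro continuous_on_divide continuous_on_subset[OF f''] continuous_at_imp_continuous_on)
      (use f' in \<open>auto intro: DERIV_isCont simp: less_imp_neq[symmetric]\<close>)
  then have "bounded ((\<lambda>x. f'' x / f' x) ` {a..b})"
    by (intro compact_imp_bounded compact_continuous_image) auto
  then obtain L where L: "0 < L" "\<And>x. x \<in> {a..b} \<Longrightarrow> norm (f'' x / f' x) \<le> L"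
    by (auto simp: bounded_pos)
  have "((\<lambda>x. ln (f' x)) has_real_derivative f'' x / f' x) (at x within {a..b})" for x
    using DERIV_chain2[OF DERIV_ln_divide f'(1), of x] f'(2) by (auto intro: DERIV_subset)
  then have "norm (ln (f' u) - ln (f' v)) \<le> L * norm (u - v)" if "u \<in> {a..b}" "v \<in> {a..b}" for u v
    by (intro field_differentiable_bound[of "{a..b}" _ "\<lambda>x. f'' x / f' x"])
      (use L(2) that in auto)
  then show thesis using that[of L] L(1) by auto
qed

text \<open>The iterates of the interval from \<open>f y\<close> to \<open>y\<close> overlap at most
  in endpoints and stay in \<open>{a..y}\<close>. Their lengths telescope to at most
  \<open>y - a\<close>, which bounds the sum of the differences of logarithms uniformly in
  \<open>n\<close>.\<close>

lemma bounded_distortion: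
  fixes f :: "real \<Rightarrow> real"
  assumes f: "strict_mono f" and a: "f a = a" "a \<le> y" and y: "f y \<le> y"
    and pos: "\<And>x. 0 < f' x" and L: "0 \<le> L"
      "\<And>u v. u \<in> {a..y} \<Longrightarrow> v \<in> {a..y} \<Longrightarrow> \<bar>ln (f' u) - ln (f' v)\<bar> \<le> L * \<bar>u - v\<bar>"
    and u: "u \<in> {f y..y}" and v: "v \<in> {f y..y}"
  shows "(\<Prod>i<n. f' ((f ^^ i) u)) \<le> exp (L * (y - a)) * (\<Prod>i<n. f' ((f ^^ i) v))"
proof -
  have mono: "(f ^^ i) s \<le> (f ^^ i) t" if "s \<le> t" for i s t
    using that strict_mono_mono[OF f] funpow_mono by blast
  have fa: "(f ^^ i) a = a" for i by (induction i) (auto simp: a)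
  have ge: "a \<le> (f ^^ i) y" for i using mono[OF a(2), of i] fa by simp
  have le: "(f ^^ i) y \<le> y" for i
  proof (induction i)
    case (Suc i)
    then show ?case using mono[OF Suc, of 1] y by simp
  qed simp
  have bnds: "(f ^^ Suc i) y \<le> (f ^^ i) t \<and> (f ^^ i) t \<le> (f ^^ i) y" if "t \<in> {f y..y}" for i t
    using that mono[of "f y" t i] mono[of t y i] by (simp add: funpow_swap1)
  have inI: "(f ^^ i) t \<in> {a..y}" if "t \<in> {f y..y}" for i t
    using bnds[OF that, of i] ge[of "Suc i"] le[of i] by auto
  have "ln (f' ((f ^^ i) u)) - ln (f' ((f ^^ i) v)) \<le> L * ((f ^^ i) y - (f ^^ Suc i) y)" for i
  proof -
    have "ln (f' ((f ^^ i) u)) - ln (f' ((f ^^ i) v)) \<le> L * \<bar>(f ^^ i) u - (f ^^ i) v\<bar>"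
      using L(2)[OF inI[OF u] inI[OF v], of i i] by linarith
    also have "\<dots> \<le> L * ((f ^^ i) y - (f ^^ Suc i) y)"
      using bnds[OF u, of i] bnds[OF v, of i] by (intro mult_left_mono[OF _ L(1)]) linarith
    finally show ?thesis .
  qed
  then have "(\<Sum>i<n. ln (f' ((f ^^ i) u)) - ln (f' ((f ^^ i) v)))
      \<le> (\<Sum>i<n. L * ((f ^^ i) y - (f ^^ Suc i) y))"
    by (intro sum_mono)
  also have "\<dots> = L * (y - (f ^^ n) y)"
    using sum_lessThan_telescope'[of "\<lambda>i. (f ^^ i) y" n] by (simp add: sum_distrib_left[symmetric])
  also have "\<dots> \<le> L * (y - a)" using ge[of n] by (intro mult_left_mono[OF _ L(1)]) linarith
  finally have "ln (\<Prod>i<n. f' ((f ^^ i) u)) \<le> L * (y - a) + ln (\<Prod>i<n. f' ((f ^^ i) v))"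
    using pos by (simp add: ln_prod sum_subtractf less_imp_neq[symmetric])
  then have "exp (ln (\<Prod>i<n. f' ((f ^^ i) u))) \<le> exp (L * (y - a) + ln (\<Prod>i<n. f' ((f ^^ i) v)))"
    by simp
  then show ?thesis using pos by (simp add: exp_add prod_pos)
qed

lemma funpow_tendsto_fixed_point:
  fixes f :: "real \<Rightarrow> real"
  assumes f: "strict_mono f" "continuous_on UNIV f" and a: "f a = a" "a < y"
    and less: "\<And>x. a < x \<Longrightarrow> x \<le> y \<Longrightarrow> f x < x"
  shows "(\<lambda>n. (f ^^ n) y) \<longlonglongrightarrow> a" "\<And>n. a < (f ^^ n) y"
proof -
  have bnd: "a < (f ^^ n) y \<and> (f ^^ n) y \<le> y" for n
  proof (induction n)
    case (Suc n)
    then show ?case using less[of "(f ^^ n) y"] strict_monoD[OF f(1), of a "(f ^^ n) y"] a by auto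
  qed (use a in auto)
  then show "\<And>n. a < (f ^^ n) y" by blast
  have "decseq (\<lambda>n. (f ^^ n) y)"
    by (rule decseq_SucI) (use less bnd in \<open>auto intro: less_imp_le\<close>)
  then obtain l where l: "(\<lambda>n. (f ^^ n) y) \<longlonglongrightarrow> l" "\<And>n. l \<le> (f ^^ n) y"
    using decseq_convergent[of "\<lambda>n. (f ^^ n) y" a] bnd less_imp_le by metis
  have "(\<lambda>n. f ((f ^^ n) y)) \<longlonglongrightarrow> f l"
    using continuous_on_tendsto_compose[OF f(2) l(1)] by simp
  moreover have "(\<lambda>n. f ((f ^^ n) y)) \<longlonglongrightarrow> l" using LIMSEQ_Suc[OF l(1)] by simp
  ultimately have "f l = l" using LIMSEQ_unique by blast
  moreover have "a \<le> l" using LIMSEQ_le_const[OF l(1)] bnd less_imp_le by blast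
  moreover have "l \<le> y" using l(2)[of 0] by simp
  ultimately have "l = a" using less[of l] by fastforce
  then show "(\<lambda>n. (f ^^ n) y) \<longlonglongrightarrow> a" using l(1) by simp
qed

text \<open>Differentiating \<open>f\<^sup>n \<circ> G = G \<circ> f\<^sup>n\<close> expresses \<open>G' x\<close> by \<open>G' (f\<^sup>n x)\<close>, which tends to
  \<open>G' a = 1\<close>, and a quotient of derivatives of \<open>f\<^sup>n\<close> controlled by bounded distortion. The bound
  does not depend on \<open>G\<close>, hence it is uniform over the powers of a map commuting with \<open>f\<close>.\<close>

lemma kopell_derivative_bound:
  fixes f G :: "real \<Rightarrow> real"
  assumes f: "strict_mono f" "continuous_on UNIV f" and a: "f a = a" "a < y"
    and less: "\<And>x. a < x \<Longrightarrow> x \<le> y \<Longrightarrow> f x < x"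
    and f': "\<And>x. (f has_real_derivative f' x) (at x)"
    and pos: "\<And>x. 0 < f' x" and L: "0 \<le> L"
      "\<And>u v. u \<in> {a..y} \<Longrightarrow> v \<in> {a..y} \<Longrightarrow> \<bar>ln (f' u) - ln (f' v)\<bar> \<le> L * \<bar>u - v\<bar>"
    and G: "strict_mono G" "\<And>x. (G has_real_derivative G' x) (at x)" "continuous_on UNIV G'"
      "\<And>x. 0 < G' x"
    and comm: "\<And>x. f (G x) = G (f x)" and Gy: "G y = y" and x: "x \<in> {f y..y}"
  shows "G' x \<le> exp (L * (y - a))"
proof -
  note yn = funpow_tendsto_fixed_point[OF f a less]
  have comm_n: "(f ^^ n) (G t) = G ((f ^^ n) t)" for n t
    by (induction n) (auto simp: comm)
  have G_yn: "G ((f ^^ n) y) = (f ^^ n) y" for n using comm_n[of n y] Gy by simp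
  have contG: "isCont G t" for t using G(2) DERIV_isCont by blast
  have Ga: "G a = a"
  proof -
    have "(\<lambda>n. G ((f ^^ n) y)) \<longlonglongrightarrow> G a" by (rule isCont_tendsto_compose[OF contG yn(1)])
    then show ?thesis using yn(1) LIMSEQ_unique unfolding G_yn by blast
  qed
  \<comment> \<open>The points \<open>(f ^^ n) y\<close> are fixed by \<open>G\<close> and tend to
    \<open>a\<close>, so the difference quotients along them are all 1.\<close>
  have G'a: "G' a = 1"
  proof -
    have "((\<lambda>t. (G t - G a) / (t - a)) \<longlongrightarrow> G' a) (at a)"
      using G(2)[of a] by (simp add: has_field_derivative_iff)
    moreover have "filterlim (\<lambda>n. (f ^^ n) y) (at a) sequentially"
      using yn by (simp add: filterlim_at less_imp_neq[symmetric])
    ultimately have "(\<lambda>n. (G ((f ^^ n) y) - G a) / ((f ^^ n) y - a)) \<longlonglongrightarrow> G' a"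
      by (rule filterlim_compose)
    moreover have "(G ((f ^^ n) y) - G a) / ((f ^^ n) y - a) = 1" for n
      using yn(2)[of n] by (simp add: G_yn Ga)
    ultimately show ?thesis by (simp add: LIMSEQ_const_iff)
  qed
  have mono: "(f ^^ i) s \<le> (f ^^ i) t" if "s \<le> t" for i s t
    using that strict_mono_mono[OF f(1)] funpow_mono by blast
  have xn: "(\<lambda>n. (f ^^ n) x) \<longlonglongrightarrow> a"
  proof (rule tendsto_sandwich[OF _ _ LIMSEQ_Suc[OF yn(1)] yn(1)])
    show "\<forall>\<^sub>F n in sequentially. (f ^^ Suc n) y \<le> (f ^^ n) x"
      using mono[of "f y" x] x by (simp add: funpow_swap1)
    show "\<forall>\<^sub>F n in sequentially. (f ^^ n) x \<le> (f ^^ n) y"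
      using mono[of x y] x by simp
  qed
  define P where "P n t = (\<Prod>i<n. f' ((f ^^ i) t))" for n t
  have P: "((f ^^ n) has_real_derivative P n t) (at t)" "0 < P n t" for n t
    using DERIV_funpow[of f f', OF f'] by (auto simp: P_def prod_pos pos)
  have "f y \<le> y" using less[of y] a by simp
  \<comment> \<open>\<open>G\<close> fixes both \<open>f y\<close> and \<open>y\<close>, so
    \<open>x\<close> and \<open>G x\<close> share a fundamental domain and the distortion bound
    compares them.\<close>
  have Gx: "G x \<in> {f y..y}"
    using x strict_mono_less_eq[OF G(1), of x y] strict_mono_less_eq[OF G(1), of "f y" x] Gy G_yn[of 1]
    by simp
  have "G' x \<le> G' ((f ^^ n) x) * exp (L * (y - a))" for n
  proof -
    have "((\<lambda>t. (f ^^ n) (G t)) has_real_derivative P n (G x) * G' x) (at x)"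
      by (rule DERIV_chain2[OF P(1) G(2)])
    moreover have "((\<lambda>t. (f ^^ n) (G t)) has_real_derivative G' ((f ^^ n) x) * P n x) (at x)"
      unfolding comm_n by (rule DERIV_chain2[OF G(2) P(1)])
    ultimately have "P n (G x) * G' x = G' ((f ^^ n) x) * P n x" by (rule DERIV_unique)
    also have "\<dots> \<le> G' ((f ^^ n) x) * (exp (L * (y - a)) * P n (G x))"
      using bounded_distortion[OF f(1) a(1) less_imp_le[OF a(2)] \<open>f y \<le> y\<close> pos L x Gx, of n] G(4)
      by (intro mult_left_mono) (auto simp: P_def less_imp_le)
    finally have "P n (G x) * G' x \<le> P n (G x) * (G' ((f ^^ n) x) * exp (L * (y - a)))"
      by (simp add: mult_ac)
    then show ?thesis using P(2) by simp
  qed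
  moreover have "(\<lambda>n. G' ((f ^^ n) x) * exp (L * (y - a))) \<longlonglongrightarrow> G' a * exp (L * (y - a))"
    using continuous_on_tendsto_compose[OF G(3) xn] by (intro tendsto_intros) auto
  ultimately show ?thesis using LIMSEQ_le_const G'a by fastforce
qed

text \<open>The orbit of \<open>x\<close> under \<open>g\<close> converges to a fixed point
  \<open>v\<close>. The powers of the inverse \<open>w\<close> share one Lipschitz constant on the
  fundamental domain, so pulling the orbit back shows that \<open>x\<close> was already
  \<open>v\<close>.\<close>

lemma kopell:
  assumes f: "f \<in> carrier Diff2R" and g: "g \<in> carrier Diff2R" and comm: "\<And>x. f (g x) = g (f x)"
    and a: "f a = a" "a < y" and less: "\<And>x. a < x \<Longrightarrow> x \<le> y \<Longrightarrow> f x < x"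
    and gy: "g y = y" and x: "x \<in> {f y..y}"
  shows "g x = x"
proof -
  note mf = Diff2R.strict_mono[OF f] and mg = Diff2R.strict_mono[OF g]
  obtain f' f'' where f': "\<And>x. (f has_real_derivative f' x) (at x)"
    "\<And>x. (f' has_real_derivative f'' x) (at x)" "continuous_on UNIV f''" "\<And>x. 0 < f' x"
    using Diff2R_derivE[OF f] by metis
  obtain L where L: "0 \<le> L"
    "\<And>u v. u \<in> {a..y} \<Longrightarrow> v \<in> {a..y} \<Longrightarrow> \<bar>ln (f' u) - ln (f' v)\<bar> \<le> L * \<bar>u - v\<bar>"
    using ln_deriv_Lipschitz[OF f'(2,4,3)] by metis
  define w where "w = inv\<^bsub>Diff2R\<^esub> g"
  have w: "w \<in> carrier Diff2R" "\<And>x. w (g x) = x" "\<And>x. g (w x) = x"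
    using g by (auto simp: w_def)
  have comm_w: "f (w x) = w (f x)" for x using comm[of "w x"] w(2,3) by metis
  have wy: "w y = y" using w(2)[of y] gy by simp
  let ?E = "exp (L * (y - a))"
  have lip: "\<bar>(w ^^ k) s - (w ^^ k) t\<bar> \<le> ?E * \<bar>s - t\<bar>" if st: "s \<in> {f y..y}" "t \<in> {f y..y}" for k s t
  proof -
    have wk: "w ^^ k \<in> carrier Diff2R" by (rule Diff2R_funpow[OF w(1)])
    obtain G' G'' where G': "\<And>x. ((w ^^ k) has_real_derivative G' x) (at x)"
      "\<And>x. (G' has_real_derivative G'' x) (at x)" "\<And>x. 0 < G' x"
      using Diff2R_derivE[OF wk] by metis
    have cG': "continuous_on UNIV G'"
      using G'(2) DERIV_isCont continuous_at_imp_continuous_on by blast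
    have com: "f ((w ^^ k) x) = (w ^^ k) (f x)" for x by (induction k) (auto simp: comm_w)
    have fixy: "(w ^^ k) y = y" by (induction k) (auto simp: wy)
    have "G' x \<le> ?E" if "x \<in> {f y..y}" for x
      by (rule kopell_derivative_bound[OF mf Diff2R.continuous[OF f] a less f'(1,4) L
            Diff2R.strict_mono[OF wk] G'(1) cG' G'(3) com fixy that])
    then have "norm (G' x) \<le> ?E" if "x \<in> {f y..y}" for x using that G'(3)[of x] by simp
    then have "norm ((w ^^ k) s - (w ^^ k) t) \<le> ?E * norm (s - t)"
      by (intro field_differentiable_bound[of "{f y..y}" _ G'])
        (use G'(1) st in \<open>auto intro: DERIV_subset\<close>)
    then show ?thesis by simp
  qed
  have inI: "g t \<in> {f y..y}" if "t \<in> {f y..y}" for t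
    using that strict_mono_less_eq[OF mg, of t y] strict_mono_less_eq[OF mg, of "f y" t] gy comm[of y]
    by simp
  have s: "(g ^^ k) x \<in> {f y..y}" for k by (induction k) (use x inI in auto)
  have "\<exists>v. (\<lambda>k. (g ^^ k) x) \<longlonglongrightarrow> v"
  proof (cases "x \<le> g x")
    case True
    have "incseq (\<lambda>k. (g ^^ k) x)"
    proof (rule incseq_SucI)
      fix k show "(g ^^ k) x \<le> (g ^^ Suc k) x"
        using funpow_mono[OF strict_mono_mono[OF mg] True, of k] by (simp add: funpow_swap1)
    qed
    moreover have "\<forall>k. (g ^^ k) x \<le> y" using s by simp
    ultimately show ?thesis using incseq_convergent by blast
  next
    case False
    then have le: "g x \<le> x" by simp
    have "decseq (\<lambda>k. (g ^^ k) x)"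
    proof (rule decseq_SucI)
      fix k show "(g ^^ Suc k) x \<le> (g ^^ k) x"
        using funpow_mono[OF strict_mono_mono[OF mg] le, of k] by (simp add: funpow_swap1)
    qed
    moreover have "\<forall>k. f y \<le> (g ^^ k) x" using s by simp
    ultimately show ?thesis using decseq_convergent by blast
  qed
  then obtain v where v: "(\<lambda>k. (g ^^ k) x) \<longlonglongrightarrow> v" by blast
  have "(\<lambda>k. g ((g ^^ k) x)) \<longlonglongrightarrow> g v"
    using continuous_on_tendsto_compose[OF Diff2R.continuous[OF g] v] by simp
  moreover have "(\<lambda>k. g ((g ^^ k) x)) \<longlonglongrightarrow> v" using LIMSEQ_Suc[OF v] by simp
  ultimately have gv: "g v = v" using LIMSEQ_unique by blast
  have vI: "v \<in> {f y..y}" using closed_sequentially[OF closed_atLeastAtMost _ v] s by blast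
  have "w v = v" using w(2)[of v] gv by simp
  then have wv: "(w ^^ k) v = v" for k by (induction k) auto
  have "(w ^^ k) ((g ^^ k) t) = t" for k t
    by (induction k arbitrary: t) (auto simp: w(2) funpow_swap1[of w])
  then have bound: "\<bar>x - v\<bar> \<le> ?E * \<bar>(g ^^ k) x - v\<bar>" for k
    using lip[OF s[of k] vI, of k] wv by simp
  have "(\<lambda>k. ?E * \<bar>(g ^^ k) x - v\<bar>) \<longlonglongrightarrow> ?E * \<bar>v - v\<bar>"
    by (intro tendsto_intros v)
  then have "\<bar>x - v\<bar> \<le> 0" using LIMSEQ_le_const[of _ _ "\<bar>x - v\<bar>"] bound by fastforce
  then show ?thesis using gv by simp
qed

text \<open>Let \<open>q\<close> be the preimage of \<open>p\<close> under \<open>f\<close> and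
  \<open>a\<close> the last fixed point of \<open>f\<close> below \<open>p\<close>. Then
  \<open>f\<close> moves all of \<open>{a<..q}\<close> down, and Kopell's lemma applies to the two
  adjacent fundamental domains ending at \<open>p\<close> and at \<open>q\<close>.\<close>

lemma kopell_near_less:
  assumes f: "f \<in> carrier Diff2R" and z: "z \<in> carrier Diff2R" and comm: "\<And>x. f (z x) = z (f x)"
    and p: "z p = p" "f p < p" and c: "f c = c" "c < p"
  shows "\<exists>d>0. \<forall>x. \<bar>x - p\<bar> < d \<longrightarrow> z x = x"
proof -
  note mf = Diff2R.strict_mono[OF f]
  define q where "q = (inv\<^bsub>Diff2R\<^esub> f) p"
  have fq: "f q = p" using f by (simp add: q_def)
  have q: "p < q" using strict_mono_less[OF mf, of p q] p(2) fq by simp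
  have "f (z q) = f q" using comm[of q] fq p(1) by simp
  then have zq: "z q = q" using strict_mono_eq[OF mf] by simp
  define B where "B = {x. f x = x} \<inter> {..p}"
  have B: "closed B" "B \<noteq> {}" "bdd_above B"
    using Diff2R.closed_fixed[OF f] c by (auto simp: B_def intro!: exI[of _ c])
  define a where "a = Sup B"
  have aB: "a \<in> B" unfolding a_def by (rule closed_contains_Sup[OF B(2,3,1)])
  then have a: "f a = a" "a < p" using p(2) by (auto simp: B_def less_le)
  have nofix: "f x \<noteq> x" if "a < x" "x \<le> q" for x
  proof
    assume fx: "f x = x"
    \<comment> \<open>A fixed point up to \<open>q\<close> satisfies
      \<open>x = f x \<le> f q = p\<close>, so none lies beyond \<open>p\<close>.\<close>
    have "x \<le> p" using strict_mono_less_eq[OF mf, of x q] that(2) fq fx by simp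
    then have "x \<in> B" using fx by (simp add: B_def)
    then show False using cSup_upper[OF _ B(3)] that(1) by (force simp: a_def)
  qed
  have less: "f x < x" if "a < x" "x \<le> q" for x
  proof (rule ccontr)
    assume "\<not> f x < x"
    then have "x < f x" using nofix[OF that] by simp
    moreover have "is_interval {a<..q}" by (auto simp: is_interval_1)
    ultimately have "p < f p"
      using no_fixed_point_less[OF Diff2R.continuous[OF f], of "{a<..q}" x p] nofix that a q by auto
    then show False using p(2) by simp
  qed
  have k1: "z x = x" if "x \<in> {f p..p}" for x
    by (rule kopell[OF f z comm a _ p(1) that]) (use less q in auto)
  have k2: "z x = x" if "x \<in> {p..q}" for x
    by (rule kopell[OF f z comm a(1) _ _ zq, of x]) (use less q a fq that in auto)
  show ?thesis
  proof (intro exI conjI allI impI)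
    show "0 < min (p - f p) (q - p)" using p(2) q by simp
    fix x assume "\<bar>x - p\<bar> < min (p - f p) (q - p)"
    then show "z x = x" using k1[of x] k2[of x] by (cases "x \<le> p") auto
  qed
qed

lemma kopell_near_below:
  assumes f: "f \<in> carrier Diff2R" and z: "z \<in> carrier Diff2R" and comm: "\<And>x. f (z x) = z (f x)"
    and p: "z p = p" "f p \<noteq> p" and c: "f c = c" "c < p"
  shows "\<exists>d>0. \<forall>x. \<bar>x - p\<bar> < d \<longrightarrow> z x = x"
proof (cases "f p < p")
  case True
  then show ?thesis using kopell_near_less[OF f z comm p(1) _ c] by blast
next
  case False
  let ?w = "inv\<^bsub>Diff2R\<^esub> f"
  have w: "?w \<in> carrier Diff2R" using f by simp
  have "?w (z x) = z (?w x)" for x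
    using comm[of "?w x"] f by (simp add: Diff2R.inv_eq_iff)
  moreover have "?w p < p"
    using False p(2) f strict_mono_less[OF Diff2R.strict_mono[OF f], of "?w p" p] by simp
  moreover have "?w c = c" using f c by (simp add: Diff2R.inv_eq_iff)
  ultimately show ?thesis using kopell_near_less[OF w z _ p(1) _ _ c(2)] by blast
qed

text \<open>Conjugation by the reflection reduces a fixed point of \<open>f\<close> above
  \<open>p\<close> to one below.\<close>

lemma Diff2R_reflect:
  assumes "f \<in> carrier Diff2R"
  shows "(\<lambda>x. - f (- x)) \<in> carrier Diff2R"
proof -
  have f: "bij f" "C2_differentiable f" "C2_differentiable (inv_into UNIV f)" "strict_mono f"
    using assms by (auto simp: Diff2R_def)
  let ?u = "uminus :: real \<Rightarrow> real"
  have u: "C2_differentiable ?u"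
    unfolding C2_differentiable_def
    by (rule exI[of _ "\<lambda>_. - 1"]) (auto intro!: derivative_eq_intros)
  have bu: "bij ?u" by (rule bij_uminus)
  have "inv_into UNIV ?u = ?u" by (rule inv_equality) auto
  then have inv: "inv_into UNIV (?u \<circ> f \<circ> ?u) = ?u \<circ> inv_into UNIV f \<circ> ?u"
    using f(1) bu by (simp add: o_inv_distrib bij_comp o_assoc)
  have "?u \<circ> f \<circ> ?u \<in> carrier Diff2R"
    unfolding Diff2R_def using f u bu
    by (auto simp: inv strict_mono_def intro!: C2_differentiable_comp bij_comp)
  then show ?thesis by (simp add: o_def)
qed

text \<open>For endpoints of components: such a point is a limit of points moved by
  \<open>z\<close>, so \<open>f\<close> cannot move it.\<close>

lemma kopell_near:
  assumes f: "f \<in> carrier Diff2R" and z: "z \<in> carrier Diff2R" and comm: "\<And>x. f (z x) = z (f x)"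
    and p: "z p = p" "f p \<noteq> p" and c: "f c = c"
  shows "\<exists>d>0. \<forall>x. \<bar>x - p\<bar> < d \<longrightarrow> z x = x"
proof (cases "c < p")
  case True
  then show ?thesis using kopell_near_below[OF f z comm p c] by blast
next
  case False
  then have "- c < - p" using p(2) c by (cases "c = p") auto
  then obtain d where d: "0 < d" "\<And>x. \<bar>x - - p\<bar> < d \<Longrightarrow> - z (- x) = x"
    using kopell_near_below[OF Diff2R_reflect[OF f] Diff2R_reflect[OF z], of "- p" "- c"] comm p c
    by auto
  have "z x = x" if "\<bar>x - p\<bar> < d" for x
  proof -
    have "\<bar>- x - - p\<bar> < d" using that by linarith
    from d(2)[OF this] show ?thesis by simp
  qed
  then show ?thesis using d(1) by blast
qed

subsection \<open>Components of the complement of a fixed point set\<close>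

text \<open>The component of \<open>x0\<close> in the complement of the fixed point set of \<open>z\<close>
  (empty if \<open>z\<close> fixes \<open>x0\<close>).\<close>

definition gap :: "(real \<Rightarrow> real) \<Rightarrow> real \<Rightarrow> real set" where
  "gap z x0 = {x. \<forall>t. z t = t \<longrightarrow> \<not> (min x0 x \<le> t \<and> t \<le> max x0 x)}"

lemma is_interval_gap: "is_interval (gap z x0)"
  unfolding is_interval_1
proof (intro ballI allI impI)
  fix a b x assume "a \<in> gap z x0" "b \<in> gap z x0" "a \<le> x \<and> x \<le> b"
  moreover have "min x0 a \<le> t \<and> t \<le> max x0 a \<or> min x0 b \<le> t \<and> t \<le> max x0 b"
    if "a \<le> x \<and> x \<le> b" "min x0 x \<le> t \<and> t \<le> max x0 x" for t
    using that by linarith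
  ultimately show "x \<in> gap z x0" unfolding gap_def by blast
qed

lemma gap_fixed_free: "x \<in> gap z x0 \<Longrightarrow> z x \<noteq> x"
  by (auto simp: gap_def)

text \<open>By \<open>loc\<close>, the fixed points of \<open>z\<close> nearest to \<open>x0\<close>
  on either side, where they exist, are fixed by \<open>h\<close>, so no fixed point of
  \<open>z\<close> separates \<open>x0\<close> from \<open>h x0\<close>. One separating
  \<open>x0\<close> from \<open>h x\<close> would pull back under \<open>h\<close> to one separating
  \<open>x0\<close> from \<open>x\<close>.\<close>

lemma (in increasing_group) gap_invariant:
  assumes h: "h \<in> carrier G" and z: "z \<in> carrier G" and comm: "\<And>x. h (z x) = z (h x)"
    and loc: "\<And>p. z p = p \<Longrightarrow> h p \<noteq> p \<Longrightarrow> \<exists>d>0. \<forall>x. \<bar>x - p\<bar> < d \<longrightarrow> z x = x"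
    and x0: "z x0 \<noteq> x0" and x: "x \<in> gap z x0"
  shows "h x \<in> gap z x0"
proof -
  note mono = strict_mono[OF h]
  have above: "h x0 < t" if t: "z t = t" "x0 \<le> t" for t
  proof -
    define B where "B = {t. z t = t} \<inter> {x0..}"
    have B: "closed B" "B \<noteq> {}" "bdd_below B"
      using closed_fixed[OF z] t by (auto simp: B_def)
    define p where "p = Inf B"
    have pB: "p \<in> B" unfolding p_def by (rule closed_contains_Inf[OF B(2,3,1)])
    then have p: "z p = p" "x0 < p" using x0 by (auto simp: B_def less_le)
    have "h p = p"
    proof (rule ccontr)
      assume "h p \<noteq> p"
      then obtain d where d: "0 < d" "\<And>x. \<bar>x - p\<bar> < d \<Longrightarrow> z x = x" using loc p(1) by blast
      \<comment> \<open>If \<open>p\<close> were moved, \<open>z\<close> would fix this point too,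
        contradicting that \<open>p\<close> is the nearest.\<close>
      define s where "s = max x0 (p - d / 2)"
      have s: "x0 \<le> s" "s < p" "\<bar>s - p\<bar> < d" using d(1) p(2) by (auto simp: s_def)
      then have "s \<in> B" using d(2) by (simp add: B_def)
      then show False using cInf_lower[OF _ B(3)] s(2) by (force simp: p_def)
    qed
    moreover have "p \<le> t" unfolding p_def by (rule cInf_lower[OF _ B(3)]) (use t in \<open>simp add: B_def\<close>)
    ultimately show ?thesis using strict_monoD[OF mono p(2)] by simp
  qed
  have below: "t < h x0" if t: "z t = t" "t \<le> x0" for t
  proof -
    define B where "B = {t. z t = t} \<inter> {..x0}"
    have B: "closed B" "B \<noteq> {}" "bdd_above B"
      using closed_fixed[OF z] t by (auto simp: B_def)
    define p where "p = Sup B"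
    have pB: "p \<in> B" unfolding p_def by (rule closed_contains_Sup[OF B(2,3,1)])
    then have p: "z p = p" "p < x0" using x0 by (auto simp: B_def less_le)
    have "h p = p"
    proof (rule ccontr)
      assume "h p \<noteq> p"
      then obtain d where d: "0 < d" "\<And>x. \<bar>x - p\<bar> < d \<Longrightarrow> z x = x" using loc p(1) by blast
      define s where "s = min x0 (p + d / 2)"
      have s: "s \<le> x0" "p < s" "\<bar>s - p\<bar> < d" using d(1) p(2) by (auto simp: s_def)
      then have "s \<in> B" using d(2) by (simp add: B_def)
      then show False using cSup_upper[OF _ B(3)] s(2) by (force simp: p_def)
    qed
    moreover have "t \<le> p" unfolding p_def by (rule cSup_upper[OF _ B(3)]) (use t in \<open>simp add: B_def\<close>)
    ultimately show ?thesis using strict_monoD[OF mono p(2)] by simp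
  qed
  have "\<not> (min x0 (h x) \<le> t \<and> t \<le> max x0 (h x))" if t: "z t = t" for t
  proof
    assume b: "min x0 (h x) \<le> t \<and> t \<le> max x0 (h x)"
    define s where "s = (inv h) t"
    have hs: "h s = t" using h by (simp add: s_def)
    have "h (z s) = h s" using comm[of s] hs t by simp
    then have zs: "z s = s" using strict_mono_eq[OF mono] by simp
    have "min (h x0) (h x) \<le> t \<and> t \<le> max (h x0) (h x)"
      using b above[OF t] below[OF t] by linarith
    then have "min x0 x \<le> s \<and> s \<le> max x0 x"
      unfolding hs[symmetric] min_le_iff_disj le_max_iff_disj strict_mono_less_eq[OF mono] .
    then show False using x zs by (auto simp: gap_def)
  qed
  then show ?thesis by (auto simp: gap_def)
qed

text \<open>The component of \<open>x0\<close> is invariant under \<open>f\<close>, \<open>g\<close>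
  and \<open>z\<close>, and \<open>z\<close> is cofinal on it. As a central commutator,
  \<open>z\<close> is then slow relative to itself, which is absurd.\<close>

lemma heisenberg_not_less:
  assumes f: "f \<in> carrier Diff2R" and g: "g \<in> carrier Diff2R" and z: "z \<in> carrier Diff2R"
    and fg: "\<And>x. f (g x) = z (g (f x))"
    and fz: "\<And>x. f (z x) = z (f x)" and gz: "\<And>x. g (z x) = z (g x)"
    and fp: "f c = c" "g d = d"
  shows "\<not> x0 < z x0"
proof
  assume less: "x0 < z x0"
  then have x0: "z x0 \<noteq> x0" by simp
  let ?X = "gap z x0"
  note inv = Diff2R.gap_invariant[OF _ z _ _ x0]
  have x0X: "x0 \<in> ?X" using x0 by (auto simp: gap_def)
  have zX: "x \<in> ?X \<Longrightarrow> z x \<in> ?X" for x by (rule inv[OF z]) auto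
  have fX: "x \<in> ?X \<Longrightarrow> f x \<in> ?X" for x
    by (rule inv[OF f fz]) (rule kopell_near[OF f z fz _ _ fp(1)])
  have gX: "x \<in> ?X \<Longrightarrow> g x \<in> ?X" for x
    by (rule inv[OF g gz]) (rule kopell_near[OF g z gz _ _ fp(2)])
  have "x < z x" if "x \<in> ?X" for x
    by (rule no_fixed_point_less[OF Diff2R.continuous[OF z] is_interval_gap _ x0X less that])
      (rule gap_fixed_free)
  then interpret cofinal_map z ?X
    by (intro cofinal_map_interval Diff2R.strict_mono Diff2R.continuous z is_interval_gap zX)
  have "centralizes f" "centralizes g" "centralizes z"
    unfolding centralizes_def
    using f g z fX gX zX fz gz by (simp_all add: Diff2R.strict_mono strict_mono_mono)
  then have "slow z" by (rule slow_commutator) (use fz gz fg in auto)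
  then show False using not_slow_z x0X by blast
qed

text \<open>The opposite inequality comes from exchanging \<open>f\<close> and \<open>g\<close>,
  which replaces \<open>z\<close> by its inverse.\<close>

lemma heisenberg_trivial:
  assumes f: "f \<in> carrier Diff2R" and g: "g \<in> carrier Diff2R" and z: "z \<in> carrier Diff2R"
    and fg: "\<And>x. f (g x) = z (g (f x))"
    and fz: "\<And>x. f (z x) = z (f x)" and gz: "\<And>x. g (z x) = z (g x)"
    and fp: "f c = c" "g d = d"
  shows "z x = x"
proof -
  let ?w = "inv\<^bsub>Diff2R\<^esub> z"
  have w: "?w \<in> carrier Diff2R" using z by simp
  have "g (f x) = ?w (f (g x))" for x using fg[of x] z by simp
  moreover have "g (?w x) = ?w (g x)" "f (?w x) = ?w (f x)" for x
    using gz[of "?w x"] fz[of "?w x"] z by simp_all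
  ultimately have "\<not> x < ?w x" by (intro heisenberg_not_less[OF g f w _ _ _ fp(2,1)])
  moreover have "\<not> x < z x" by (rule heisenberg_not_less[of f g z, OF f g z fg fz gz fp])
  ultimately show ?thesis using Diff2R.inv_less_iff[OF z, of x] by linarith
qed

theorem theorem1p4:
  fixes H :: "(real \<Rightarrow> real) set"
  assumes "subgroup H Diff2R"
    and "nilpotent (Diff2R\<lparr>carrier := H\<rparr>)"
  shows "metabelian (Diff2R\<lparr>carrier := H\<rparr>)"
proof -
  let ?G = "Diff2R\<lparr>carrier := H\<rparr>"
  have HD: "h \<in> carrier Diff2R" if "h \<in> H" for h
    using subgroup.mem_carrier[OF assms(1) that] .
  interpret increasing_group ?G
  proof (intro increasing_group.intro increasing_group_axioms.intro)
    show "group ?G" by (rule subgroup.subgroup_is_group[OF assms(1) group_Diff2R])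
    show "f \<otimes>\<^bsub>?G\<^esub> g = f \<circ> g" "\<one>\<^bsub>?G\<^esub> = id" for f g
      by (simp_all add: Diff2R_def)
    show "strict_mono f" if "f \<in> carrier ?G" for f
      by (rule Diff2R.strict_mono[OF HD]) (use that in simp)
  qed
  let ?\<gamma> = "lower_central_series ?G"
  obtain n where n: "?\<gamma> n = {\<one>\<^bsub>?G\<^esub>}" using assms(2) unfolding nilpotent_def by blast
  have HG: "f \<in> carrier ?G" if "f \<in> ?\<gamma> k" for f k
    using lower_central_series_subset that by blast
  have le: "?\<gamma> (Suc k) \<subseteq> ?\<gamma> 1" for k
    by (induction k) (use lower_central_series_Suc_subset in auto)
  \<comment> \<open>Downward induction from \<open>k = n\<close>, where \<open>f\<close> is the
    identity, to \<open>k = 0\<close>. Keeping \<open>g\<close> in all of \<open>?\<gamma> 1\<close>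
    lets the hypothesis for the commutator \<open>z\<close>, one term further down, apply to both
    \<open>f\<close> and \<open>g\<close>.\<close>
  have commute: "f \<circ> g = g \<circ> f" if "f \<in> ?\<gamma> (Suc k)" "g \<in> ?\<gamma> 1" "k \<le> n" for f g k
    using that(3,1,2)
  proof (induction k arbitrary: f g rule: inc_induct)
    case base
    then have "f = id" using lower_central_series_Suc_subset[of n] n one_eq by auto
    then show ?case by simp
  next
    case (step k)
    have f1: "f \<in> ?\<gamma> 1" using le step.prems(1) by blast
    note f = HG[OF f1] and g = HG[OF step.prems(2)]
    define z where "z = g \<otimes>\<^bsub>?G\<^esub> f \<otimes>\<^bsub>?G\<^esub> inv\<^bsub>?G\<^esub> g \<otimes>\<^bsub>?G\<^esub> inv\<^bsub>?G\<^esub> f"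
    have z: "z \<in> ?\<gamma> (Suc (Suc k))"
      unfolding z_def by (rule commutator_in_lower_central_series[OF g step.prems(1)])
    obtain c d where cd: "f c = c" "g d = d"
      using fixed_point_derived[OF n] f1 step.prems(2) by blast
    have "f (z x) = z (f x)" "g (z x) = z (g x)" for x
      using fun_cong[OF step.IH[OF z f1], of x] fun_cong[OF step.IH[OF z step.prems(2)], of x]
      by simp_all
    moreover have gf: "g (f x) = z (f (g x))" for x
      unfolding z_def using commutator_apply(1)[OF g f] by simp
    ultimately have "z x = x" for x
      using heisenberg_trivial[of g f z] HD f g HG[OF z] cd by simp
    then show ?case using gf by auto
  qed
  \<comment> \<open>With indices starting at 0, term 1 is the derived subgroup;
    \<open>commute\<close> at \<open>k = 0\<close> covers it.\<close>
  have "derived ?G (carrier ?G) = ?\<gamma> 1"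
    unfolding derived_eq_commutator_subgroup One_nat_def lower_central_series.simps ..
  moreover have "comm_group (?G\<lparr>carrier := ?\<gamma> 1\<rparr>)"
  proof (rule group.group_comm_groupI)
    show "group (?G\<lparr>carrier := ?\<gamma> 1\<rparr>)"
      by (rule subgroup.subgroup_is_group[OF lower_central_series_subgroup group_axioms])
  qed (use commute[of _ 0] mult_eq in simp)
  ultimately show ?thesis unfolding metabelian_def by simp
qed

end
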